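(* For every integer $n \ge 2$ we have $g_4(n) = 3$.
   Context: For positive integers $n$ and $k \ge 3$, $g_k(n)$ denotes the smallest integer such that for every set $A \subseteq \{1, 2, \ldots, 2n\}$ with $|A| \ge n + g_k(n)$ there exist pairwise distinct integers $b_1, \ldots, b_k$ (arbitrary integers, not required to be positive or to lie in $A$) with $b_i + b_j \in A$ for all $1 \le i < j \le k$. *)

theory Defs
  imports Main
begin

definition pairwise_sums_in :: "nat \<Rightarrow> int set \<Rightarrow> bool" where
  "pairwise_sums_in k A \<longleftrightarrow>
     (\<exists>b :: nat \<Rightarrow> int. inj_on b {1..k} \<and>
        (\<forall>i\<in>{1..k}. \<forall>j\<in>{1..k}. i < j \<longrightarrow> b i + b j \<in> A))"

definition threshold :: "nat \<Rightarrow> nat \<Rightarrow> int \<Rightarrow> bool" where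
  "threshold k n t \<longleftrightarrow>
     (\<forall>A \<subseteq> {1..2 * int n}. int (card A) \<ge> int n + t \<longrightarrow> pairwise_sums_in k A)"

definition g :: "nat \<Rightarrow> nat \<Rightarrow> int" where
  "g k n = (LEAST t. threshold k n t)"

text \<open>
  The least element in the definition of \<open>g\<close> ranges over all integers, including negative ones,
  and integers are not well-ordered. For \<open>k \<ge> 2\<close> it nevertheless exists: \<open>t = n + 1\<close> is a
  threshold vacuously, and no \<open>t \<le> -n\<close> is one, because of the empty set.
\<close>

lemma
  assumes "k \<ge> 2"
  shows threshold_g: "threshold k n (g k n)"
    and g_le: "\<And>t. threshold k n t \<Longrightarrow> g k n \<le> t"
proof -
  have vac: "threshold k n (int n + 1)"
    unfolding threshold_def
  proof (intro allI impI)
    fix A assume A: "A \<subseteq> {1..2 * int n}" and c: "int n + (int n + 1) \<le> int (card A)"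
    have "card A \<le> card {1..2 * int n}"
      using A by (intro card_mono) auto
    with c show "pairwise_sums_in k A" by simp
  qed
  have low: "- int n < t" if "threshold k n t" for t
  proof (rule ccontr)
    assume "\<not> - int n < t"
    then have "pairwise_sums_in k {}"
      using that[unfolded threshold_def, rule_format, of "{}"] by simp
    then obtain b :: "nat \<Rightarrow> int"
      where b: "\<forall>i\<in>{1..k}. \<forall>j\<in>{1..k}. i < j \<longrightarrow> b i + b j \<in> {}"
      unfolding pairwise_sums_in_def by auto
    have "1 \<in> {1..k}" "2 \<in> {1..k}" using assms by auto
    with b show False by fastforce
  qed
  define m where "m = (LEAST d. threshold k n (int d - int n))"
  have "threshold k n (int (2 * n + 1) - int n)" using vac by simp
  then have m: "threshold k n (int m - int n)"
    unfolding m_def by (rule LeastI)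
  have min: "int m - int n \<le> t" if "threshold k n t" for t
  proof -
    have "t = int (nat (t + int n)) - int n" using low[OF that] by simp
    with that have "threshold k n (int (nat (t + int n)) - int n)" by simp
    then have "m \<le> nat (t + int n)" unfolding m_def by (rule Least_le)
    with low[OF that] show ?thesis by simp
  qed
  have eq: "g k n = int m - int n"
    unfolding g_def using m min by (rule Least_equality)
  show "threshold k n (g k n)" using m eq by simp
  show "\<And>t. threshold k n t \<Longrightarrow> g k n \<le> t" using min eq by simp
qed

end

theory Submission
  imports Defs
begin

text \<open>
  Upper bound: among the \<open>n\<close> pairs \<open>{x, 2n + 1 - x}\<close> at least three lie inside a set of size
  \<open>n + 3\<close>. The common sum \<open>2n + 1\<close> is odd, so one can pick one number from each of them with even
  total, and these three are the pairwise sums of integers \<open>b\<^sub>1, b\<^sub>2, b\<^sub>3\<close>. The complements of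
  the three numbers are then the sums \<open>b\<^sub>i + b\<^sub>4\<close> with \<open>b\<^sub>4 = 2n + 1 - b\<^sub>1 - b\<^sub>2 - b\<^sub>3\<close>.

  Lower bound: take all odd numbers together with \<open>2n - 2\<close> and \<open>2n\<close>. Three \<open>b\<^sub>i\<close> of equal parity
  would give three even sums, so two \<open>b\<^sub>i\<close> are even and two are odd. The two even sums
  are at least \<open>2n - 2\<close>, and then the larger even \<open>b\<^sub>i\<close> plus the larger odd one is at least \<open>2n\<close>,
  which is impossible for an odd element.
\<close>

lemma pairwise_sums_in_4_iff:
  "pairwise_sums_in 4 A \<longleftrightarrow>
    (\<exists>x y z w. distinct [x, y, z, w] \<and>
      x + y \<in> A \<and> x + z \<in> A \<and> x + w \<in> A \<and> y + z \<in> A \<and> y + w \<in> A \<and> z + w \<in> A)"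
    (is "?L \<longleftrightarrow> ?R")
proof -
  have set4: "{1..4::nat} = {1, 2, 3, 4}" by auto
  show ?thesis
  proof
    assume ?L
    then obtain b :: "nat \<Rightarrow> int" where inj: "inj_on b {1, 2, 3, 4}"
      and sums: "\<forall>i\<in>{1, 2, 3, 4}. \<forall>j\<in>{1, 2, 3, 4}. i < j \<longrightarrow> b i + b j \<in> A"
      unfolding pairwise_sums_in_def set4 by blast
    have "distinct [b 1, b 2, b 3, b 4]" using inj by simp
    with sums show ?R
      by (intro exI[of _ "b 1"] exI[of _ "b 2"] exI[of _ "b 3"] exI[of _ "b 4"]) simp
  next
    assume ?R
    then obtain x y z w where d: "distinct [x, y, z, w]"
      and sums: "x + y \<in> A" "x + z \<in> A" "x + w \<in> A" "y + z \<in> A" "y + w \<in> A" "z + w \<in> A"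
      by blast
    define b :: "nat \<Rightarrow> int" where
      "b i = (if i = 1 then x else if i = 2 then y else if i = 3 then z else w)" for i
    have "inj_on b {1, 2, 3, 4}" using d by (simp add: b_def)
    moreover have "\<forall>i\<in>{1, 2, 3, 4}. \<forall>j\<in>{1, 2, 3, 4}. i < j \<longrightarrow> b i + b j \<in> A"
      using sums by (simp add: b_def)
    ultimately show ?L unfolding pairwise_sums_in_def set4 by blast
  qed
qed

lemma pairwise_sums_in_4_of_even_total:
  fixes p q r s :: int
  assumes "even (p + q + r)"
    and "distinct [p, q, r]" and "p + q \<noteq> s" "p + r \<noteq> s" "q + r \<noteq> s"
    and "p \<in> A" "q \<in> A" "r \<in> A" "s - p \<in> A" "s - q \<in> A" "s - r \<in> A"
  shows "pairwise_sums_in 4 A"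
proof -
  \<comment> \<open>Solving b1 + b2 = p, b1 + b3 = q, b2 + b3 = r gives \<open>h - r\<close>,
    \<open>h - q\<close>, \<open>h - p\<close>; evenness makes \<open>h\<close> an integer. The
    fourth number is \<open>s - h\<close>.\<close>
  obtain h where h: "p + q + r = 2 * h" using assms(1) by (elim evenE)
  have sums: "h - r + (h - q) = p" "h - r + (h - p) = q" "h - q + (h - p) = r"
    "h - r + (s - h) = s - r" "h - q + (s - h) = s - q" "h - p + (s - h) = s - p"
    using h by linarith+
  \<comment> \<open>Since \<open>2 * h = p + q + r\<close>, the equality
    \<open>h - r = s - h\<close> would mean \<open>p + q = s\<close>; likewise for the
    others.\<close>
  have ne: "h - r \<noteq> s - h" "h - q \<noteq> s - h" "h - p \<noteq> s - h"
    using assms(3-5) h by linarith+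
  show ?thesis
    unfolding pairwise_sums_in_4_iff
  proof (intro exI conjI)
    show "distinct [h - r, h - q, h - p, s - h]" using assms(2) ne by auto
  qed (simp_all only: sums assms)
qed

text \<open>Fold the upper half of \<open>A\<close> onto the lower half by reflection: the union of
  both parts fits into \<open>{1..int n}\<close>, and their overlap marks the pairs lying fully in
  \<open>A\<close>.\<close>

lemma card_reflected_pairs:
  fixes A :: "int set"
  assumes "A \<subseteq> {1..2 * int n}"
  shows "card A \<le> n + card {x \<in> {1..int n}. x \<in> A \<and> 2 * int n + 1 - x \<in> A}"
proof -
  define U where "U = A \<inter> {1..int n}"
  define V where "V = (\<lambda>x. 2 * int n + 1 - x) ` (A \<inter> {int n + 1..2 * int n})"
  have fin: "finite U" "finite V" by (simp_all add: U_def V_def)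
  have "A = U \<union> (A \<inter> {int n + 1..2 * int n})" using assms by (auto simp: U_def)
  then have "card A \<le> card U + card (A \<inter> {int n + 1..2 * int n})"
    by (metis card_Un_le)
  also have "card (A \<inter> {int n + 1..2 * int n}) = card V"
    unfolding V_def by (rule card_image[symmetric]) (simp add: inj_on_def)
  also have "card U + card V = card (U \<union> V) + card (U \<inter> V)"
    using fin by (rule card_Un_Int)
  also have "card (U \<union> V) \<le> card {1..int n}"
    by (rule card_mono) (auto simp: U_def V_def)
  also have "U \<inter> V = {x \<in> {1..int n}. x \<in> A \<and> 2 * int n + 1 - x \<in> A}"
  proof (intro equalityI subsetI)
    fix x assume "x \<in> {x \<in> {1..int n}. x \<in> A \<and> 2 * int n + 1 - x \<in> A}"
    then have "x \<in> U" and "2 * int n + 1 - x \<in> A \<inter> {int n + 1..2 * int n}"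
      by (auto simp: U_def)
    then show "x \<in> U \<inter> V" unfolding V_def by (intro IntI rev_image_eqI[of "2 * int n + 1 - x"]) simp_all
  qed (auto simp: U_def V_def)
  finally show ?thesis by simp
qed

lemma threshold_4: "threshold 4 n 3"
  unfolding threshold_def
proof (intro allI impI)
  fix A :: "int set"
  assume A: "A \<subseteq> {1..2 * int n}" and c: "int n + 3 \<le> int (card A)"
  define s where "s = 2 * int n + 1"
  define P where "P = {x \<in> {1..int n}. x \<in> A \<and> s - x \<in> A}"
  have "3 \<le> card P"
    using card_reflected_pairs[OF A] c unfolding P_def s_def by linarith
  then obtain T where "T \<subseteq> P" "card T = 3" by (rule obtain_subset_with_card_n)
  then obtain x y z where xyz: "x \<in> P" "y \<in> P" "z \<in> P" "x \<noteq> y" "y \<noteq> z" "x \<noteq> z"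
    by (auto simp: card_3_iff)
  then have le: "x \<le> int n" "y \<le> int n" "z \<le> int n"
    and mem: "x \<in> A" "y \<in> A" "z \<in> A" "s - x \<in> A" "s - y \<in> A" "s - z \<in> A"
    by (auto simp: P_def)
  show "pairwise_sums_in 4 A"
  proof (cases "even (x + y + z)")
    case True
    then show ?thesis
      using xyz le mem
      \<comment> \<open>Two numbers up to n add up to at most 2n, which is less than
        \<open>s\<close>.\<close>
      by (intro pairwise_sums_in_4_of_even_total[of x y z s]) (auto simp: s_def)
  next
    case False
    \<comment> \<open>As \<open>s\<close> is odd, reflecting one number flips the parity of the
      total. The number \<open>s - x\<close> exceeds n, so it differs from \<open>y\<close> and
      \<open>z\<close>, and \<open>s - x + y = s\<close> would force \<open>x = y\<close>.\<close>
    then have "even (s - x + y + z)" by (auto simp: s_def)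
    then show ?thesis
      using xyz le mem
      by (intro pairwise_sums_in_4_of_even_total[of "s - x" y z s]) (auto simp: s_def)
  qed
qed

definition extremal_set :: "nat \<Rightarrow> int set" where
  "extremal_set n = {x \<in> {1..2 * int n}. odd x} \<union> {2 * int n - 2, 2 * int n}"

text \<open>For n = 1 the element 2n - 2 would be 0, outside the interval.\<close>

lemma extremal_set_subset: "n \<ge> 2 \<Longrightarrow> extremal_set n \<subseteq> {1..2 * int n}"
  by (auto simp: extremal_set_def)

lemma extremal_setD:
  assumes "x \<in> extremal_set n"
  shows "x \<le> 2 * int n" and "even x \<Longrightarrow> x = 2 * int n - 2 \<or> x = 2 * int n"
  using assms by (auto simp: extremal_set_def)

lemma card_extremal_set: "card (extremal_set n) = n + 2"
proof -
  have odds: "{x \<in> {1..2 * int n}. odd x} = (\<lambda>k. 2 * k - 1) ` {1..int n}"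
  proof (intro equalityI subsetI)
    fix x assume "x \<in> {x \<in> {1..2 * int n}. odd x}"
    then obtain k where "x = 2 * k + 1" "1 \<le> x" "x \<le> 2 * int n" by (auto elim: oddE)
    then have "x = 2 * (k + 1) - 1" "k + 1 \<in> {1..int n}" by auto
    then show "x \<in> (\<lambda>k. 2 * k - 1) ` {1..int n}" by blast
  qed auto
  have "card {x \<in> {1..2 * int n}. odd x} = n"
    unfolding odds by (subst card_image) (auto simp: inj_on_def)
  moreover have "finite {x \<in> {1..2 * int n}. odd x}" unfolding odds by simp
  ultimately show ?thesis
    unfolding extremal_set_def by (subst card_Un_disjoint) (simp_all del: atLeastAtMost_iff)
qed

text \<open>Three distinct even sums do not fit into two even elements.\<close>

lemma extremal_set_no_equal_parity_triple:
  assumes "distinct [x, y, z]" "even (x + y)" "even (x + z)"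
    and "x + y \<in> extremal_set n" "x + z \<in> extremal_set n" "y + z \<in> extremal_set n"
  shows False
proof -
  have "even (y + z)" using assms(2,3) by presburger
  then have "{x + y, x + z, y + z} \<subseteq> {2 * int n - 2, 2 * int n}"
    using assms extremal_setD(2) by blast
  then have "card {x + y, x + z, y + z} \<le> card {2 * int n - 2, 2 * int n}"
    by (rule card_mono[rotated]) simp
  moreover have "card {x + y, x + z, y + z} = 3" using assms(1) by simp
  ultimately show False by simp
qed

lemma extremal_set_no_two_parity_pairs:
  assumes "x < y" "z < w" "even (x + y)" "even (z + w)" "odd (y + w)"
    and "x + y \<in> extremal_set n" "z + w \<in> extremal_set n" "y + w \<in> extremal_set n"
  shows False
proof -
  \<comment> \<open>Distinct integers of equal parity differ by at least 2, so 2y \<ge> x + y + 2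
    \<ge> 2n, and likewise for \<open>w\<close>.\<close>
  have "x + 2 \<le> y" "z + 2 \<le> w" using assms(1-4) by presburger+
  moreover have "2 * int n - 2 \<le> x + y" "2 * int n - 2 \<le> z + w"
    using assms(3,4) extremal_setD(2)[OF assms(6)] extremal_setD(2)[OF assms(7)] by auto
  ultimately have "2 * int n \<le> y + w" by linarith
  with extremal_setD(1)[OF assms(8)] have "y + w = 2 * int n" by linarith
  with assms(5) show False by simp
qed

text \<open>Either member of each pair may be the larger one, hence all four cross sums are
  assumed.\<close>

lemma extremal_set_no_crossing_pairs:
  assumes "distinct [x, y, z, w]" "even (x + y)" "even (z + w)" "odd (x + z)"
    and "x + y \<in> extremal_set n" "z + w \<in> extremal_set n" "x + z \<in> extremal_set n"
      "x + w \<in> extremal_set n" "y + z \<in> extremal_set n" "y + w \<in> extremal_set n"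
  shows False
proof -
  have par: "odd (x + w)" "odd (y + z)" "odd (y + w)" using assms(2-4) by presburger+
  consider "x < y" "z < w" | "x < y" "w < z" | "y < x" "z < w" | "y < x" "w < z"
    using assms(1) by (auto simp: neq_iff)
  then show False
  proof cases
    case 1
    show ?thesis
      by (rule extremal_set_no_two_parity_pairs[of x y z w n]) (use 1 assms par in \<open>simp_all\<close>)
  next
    case 2
    show ?thesis
      by (rule extremal_set_no_two_parity_pairs[of x y w z n])
        (use 2 assms par in \<open>simp_all add: add.commute\<close>)
  next
    case 3
    show ?thesis
      by (rule extremal_set_no_two_parity_pairs[of y x z w n])
        (use 3 assms par in \<open>simp_all add: add.commute\<close>)
  next
    case 4
    show ?thesis
      by (rule extremal_set_no_two_parity_pairs[of y x w z n])
        (use 4 assms par in \<open>simp_all add: add.commute\<close>)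
  qed
qed

lemma not_pairwise_sums_in_extremal_set: "\<not> pairwise_sums_in 4 (extremal_set n)"
proof
  assume "pairwise_sums_in 4 (extremal_set n)"
  then obtain x y z w where d: "distinct [x, y, z, w]"
    and sums: "x + y \<in> extremal_set n" "x + z \<in> extremal_set n" "x + w \<in> extremal_set n"
      "y + z \<in> extremal_set n" "y + w \<in> extremal_set n" "z + w \<in> extremal_set n"
    unfolding pairwise_sums_in_4_iff by blast
  note triple = extremal_set_no_equal_parity_triple[where n = n]
  note crossing = extremal_set_no_crossing_pairs[where n = n]
  have sums': "z + y \<in> extremal_set n" "w + y \<in> extremal_set n" "w + z \<in> extremal_set n"
    using sums by (simp_all add: add.commute)
  \<comment> \<open>The first four cases are the triples of equal parity; the last three are the
    splittings into an even and an odd pair.\<close>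
  consider "even (x + y)" "even (x + z)" | "even (x + y)" "even (x + w)"
    | "even (x + z)" "even (x + w)" | "even (y + z)" "even (y + w)"
    | "even (x + y)" "even (z + w)" "odd (x + z)"
    | "even (x + z)" "even (y + w)" "odd (x + y)"
    | "even (x + w)" "even (y + z)" "odd (x + y)"
    by (cases "even x"; cases "even y"; cases "even z"; cases "even w") simp_all
  then show False
  proof cases
    case 1 then show ?thesis using triple[of x y z] d sums by simp
  next
    case 2 then show ?thesis using triple[of x y w] d sums by simp
  next
    case 3 then show ?thesis using triple[of x z w] d sums by simp
  next
    case 4 then show ?thesis using triple[of y z w] d sums by simp
  next
    case 5 then show ?thesis using crossing[of x y z w] d sums by simp
  next
    case 6 then show ?thesis using crossing[of x z y w] d sums sums' by simp
  next
    case 7 then show ?thesis using crossing[of x w y z] d sums sums' by simp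
  qed
qed

theorem theorem4:
  fixes n :: nat
  assumes "n \<ge> 2"
  shows "g 4 n = 3"
proof (rule antisym)
  show "g 4 n \<le> 3" using threshold_4 by (intro g_le) simp_all
  show "3 \<le> g 4 n"
  proof (rule ccontr)
    assume "\<not> 3 \<le> g 4 n"
    then have "int n + g 4 n \<le> int (card (extremal_set n))"
      by (simp add: card_extremal_set)
    moreover have "threshold 4 n (g 4 n)" by (rule threshold_g) simp
    ultimately have "pairwise_sums_in 4 (extremal_set n)"
      using extremal_set_subset[OF assms] unfolding threshold_def by blast
    with not_pairwise_sums_in_extremal_set show False by blast
  qed
qed

end
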